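(* Let $\equiv$ be either $\equiv_{s,a}$ or $\equiv_{s,s}$. Let $T_1=\langle P_1,Q_1\rangle$ and $T_2=\langle P_2,Q_2\rangle$ be pairs of programs with $T_1\approx T_2$. (I) If $IC(T_1)=IC(T_2)$, then $P_1\equiv Q_1$ iff $P_2\equiv Q_2$. (II) If $IC(T_1)<IC(T_2)$, then $P_1\not\equiv Q_1$ implies $P_2\not\equiv Q_2$, and $P_2\equiv Q_2$ implies $P_1\equiv Q_1$.
   Context: Atoms are propositional. A rule $r$ is an expression $h_1\vee\cdots\vee h_k\leftarrow b_1,\dots,b_m,\mathit{not}\,c_1,\dots,\mathit{not}\,c_n$; write $H(r)$, $B^+(r)$, $B^-(r)$ for the sets of head, positive body and negative body atoms. A program is a finite set of rules. An interpretation $X$ satisfies $r$ iff $X\cap H(r)\neq\emptyset$ or $B^+(r)\not\subseteq X$ or $B^-(r)\cap X\neq\emptyset$. GL-reduct $P^X=\{H(r)\leftarrow B^+(r) : r\in P,\ B^-(r)\cap X=\emptyset\}$; $X$ is an ASP stable model of $P$ iff $X\models P^X$ and no proper subset of $X$ satisfies $P^X$; $X$ is an LP$^{\mathrm{MLN}}$ stable model of $P$ (weights omitted) iff $X$ is an ASP stable model of $\{r\in P: X\models r\}$. $P\equiv_{s,a}Q$ (resp. $P\equiv_{s,s}Q$) iff for every program $R$, $P\cup R$ and $Q\cup R$ have the same ASP (resp. LP$^{\mathrm{MLN}}$) stable models. Programs are regarded as tuples of rules (repetitions allowed); $\langle P,Q\rangle$ is the concatenation. For a tuple $T=\langle r_1,\dots,r_n\rangle$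 let $\langle S_1,\dots,S_{3n}\rangle=\langle H(r_1),B^+(r_1),B^-(r_1),\dots,H(r_n),B^+(r_n),B^-(r_n)\rangle$; for nonempty $N'\subseteq\{1,\dots,3n\}$ the independent set $I_{N'}=\bigcap_{i\in N'}S_i\setminus\bigcup_{j\notin N'}S_j$ is named $I_k$ with $k=\sum_{i\in N'}2^{3n-i}$ ($1\le k<2^{3n}$). Let $nis(T)$, $eis(T)$, $sis(T)$ be the sets of names $k$ with $I_k\neq\emptyset$, $I_k=\emptyset$, $|I_k|=1$ respectively. The IS-condition $IC(T)$ is the formula $\bigwedge_{i\in nis(T)}(I_i\neq\emptyset)\wedge\bigwedge_{j\in eis(T)}(I_j=\emptyset)\wedge\bigwedge_{k\in sis(T)}(|I_k|=1)$. For pairs, $\langle P_1,Q_1\rangle\approx\langle P_2,Q_2\rangle$ iff $|P_1|=|P_2|$ and $|Q_1|=|Q_2|$. For $T_1\approx T_2$: $IC(T_1)=IC(T_2)$ iff $nis(T_1)=nis(T_2)$ and $sis(T_1)=sis(T_2)$; $IC(T_1)<IC(T_2)$ iff $nis(T_1)=nis(T_2)$ and $sis(T_2)\subsetneq sis(T_1)$. *)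

theory Defs
  imports Main
begin

datatype 'a rule = Rule (head: "'a list") (pos_body: "'a list") (neg_body: "'a list")

definition H :: "'a rule \<Rightarrow> 'a set" where
  "H r = set (head r)"

definition Bpos :: "'a rule \<Rightarrow> 'a set" where
  "Bpos r = set (pos_body r)"

definition Bneg :: "'a rule \<Rightarrow> 'a set" where
  "Bneg r = set (neg_body r)"

definition sat_rule :: "'a set \<Rightarrow> 'a rule \<Rightarrow> bool" where
  "sat_rule X r \<longleftrightarrow> X \<inter> H r \<noteq> {} \<or> \<not> Bpos r \<subseteq> X \<or> Bneg r \<inter> X \<noteq> {}"

definition sat_program :: "'a set \<Rightarrow> 'a rule set \<Rightarrow> bool" where
  "sat_program X P \<longleftrightarrow> (\<forall>r\<in>P. sat_rule X r)"

definition GL_reduct :: "'a rule set \<Rightarrow> 'a set \<Rightarrow> 'a rule set" where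
  "GL_reduct P X = {Rule (head r) (pos_body r) [] | r. r \<in> P \<and> Bneg r \<inter> X = {}}"

definition asp_stable_model :: "'a rule set \<Rightarrow> 'a set \<Rightarrow> bool" where
  "asp_stable_model P X \<longleftrightarrow>
     sat_program X (GL_reduct P X) \<and> \<not> (\<exists>Y. Y \<subset> X \<and> sat_program Y (GL_reduct P X))"

definition lpmln_stable_model :: "'a rule set \<Rightarrow> 'a set \<Rightarrow> bool" where
  "lpmln_stable_model P X \<longleftrightarrow> asp_stable_model {r \<in> P. sat_rule X r} X"

text \<open>The two programs compared are tuples (lists) of rules. They enter the semantics only
  through their underlying finite sets of rules.\<close>

definition strong_equiv_asp :: "'a rule list \<Rightarrow> 'a rule list \<Rightarrow> bool" where
  "strong_equiv_asp P Q \<longleftrightarrow>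
     (\<forall>R. finite R \<longrightarrow>
        {X. asp_stable_model (set P \<union> R) X} = {X. asp_stable_model (set Q \<union> R) X})"

definition strong_equiv_lpmln :: "'a rule list \<Rightarrow> 'a rule list \<Rightarrow> bool" where
  "strong_equiv_lpmln P Q \<longleftrightarrow>
     (\<forall>R. finite R \<longrightarrow>
        {X. lpmln_stable_model (set P \<union> R) X} = {X. lpmln_stable_model (set Q \<union> R) X})"

definition component_sets :: "'a rule list \<Rightarrow> 'a set list" where
  "component_sets T = concat (map (\<lambda>r. [H r, Bpos r, Bneg r]) T)"

text \<open>Positions in the tuple of component sets are counted from 1.\<close>

definition component :: "'a rule list \<Rightarrow> nat \<Rightarrow> 'a set" where
  "component T i = component_sets T ! (i - 1)"

definition ind_set :: "'a rule list \<Rightarrow> nat set \<Rightarrow> 'a set" where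
  "ind_set T N = (\<Inter>i\<in>N. component T i) - (\<Union>j\<in>{1..3 * length T} - N. component T j)"

definition ind_set_name :: "'a rule list \<Rightarrow> nat set \<Rightarrow> nat" where
  "ind_set_name T N = (\<Sum>i\<in>N. 2 ^ (3 * length T - i))"

definition nis :: "'a rule list \<Rightarrow> nat set" where
  "nis T = {ind_set_name T N | N. N \<noteq> {} \<and> N \<subseteq> {1..3 * length T} \<and> ind_set T N \<noteq> {}}"

definition eis :: "'a rule list \<Rightarrow> nat set" where
  "eis T = {ind_set_name T N | N. N \<noteq> {} \<and> N \<subseteq> {1..3 * length T} \<and> ind_set T N = {}}"

definition sis :: "'a rule list \<Rightarrow> nat set" where
  "sis T = {ind_set_name T N | N. N \<noteq> {} \<and> N \<subseteq> {1..3 * length T} \<and> card (ind_set T N) = 1}"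

type_synonym 'a program_pair = "'a rule list \<times> 'a rule list"

definition pair_tuple :: "'a program_pair \<Rightarrow> 'a rule list" where
  "pair_tuple T = fst T @ snd T"

definition similar :: "'a program_pair \<Rightarrow> 'a program_pair \<Rightarrow> bool" (infix \<open>\<approx>\<close> 50) where
  "T1 \<approx> T2 \<longleftrightarrow> length (fst T1) = length (fst T2) \<and> length (snd T1) = length (snd T2)"

text \<open>An IS-condition is the formula determined by \<open>nis\<close>, \<open>eis\<close> and \<open>sis\<close>. The relations
  between IS-conditions are meant for similar pairs, for which \<open>eis\<close> is determined
  by \<open>nis\<close>.\<close>

definition IC_eq :: "'a program_pair \<Rightarrow> 'a program_pair \<Rightarrow> bool" where
  "IC_eq T1 T2 \<longleftrightarrow>
     nis (pair_tuple T1) = nis (pair_tuple T2) \<and> sis (pair_tuple T1) = sis (pair_tuple T2)"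

definition IC_less :: "'a program_pair \<Rightarrow> 'a program_pair \<Rightarrow> bool" where
  "IC_less T1 T2 \<longleftrightarrow>
     nis (pair_tuple T1) = nis (pair_tuple T2) \<and> sis (pair_tuple T2) \<subset> sis (pair_tuple T1)"

end

theory Submission
  imports Defs "HOL-Library.Nat_Bijection"
begin

text \<open>
  Strong equivalence in either sense amounts to having the same SE-models. Whether \<open>(X, Y)\<close>
  with \<open>Y \<subseteq> X\<close> is an SE-model depends, for each independent set \<open>I\<close>, only on which of
  \<open>X\<close> and \<open>Y\<close> meet or contain \<open>I\<close>. As \<open>X\<close> and \<open>Y\<close> form a chain, two elements of \<open>I\<close> already
  give the same answers: one lying in as few and one lying in as many of the sets \<open>X\<close>, \<open>Y\<close> as
  possible. Hence the independent set of the same name in the second tuple can be mapped into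
  \<open>I\<close> so that its image gives these answers, unless it is a singleton and \<open>I\<close> is not, which
  the condition on \<open>sis\<close> excludes. The preimages of \<open>X\<close> and \<open>Y\<close> under the resulting map
  of atoms then satisfy the same rules of the second tuple as \<open>X\<close> and \<open>Y\<close> do of the first,
  so a pair separating \<open>P\<^sub>1\<close> from \<open>Q\<^sub>1\<close> yields one separating \<open>P\<^sub>2\<close> from \<open>Q\<^sub>2\<close>.
\<close>

section \<open>Strong equivalence and SE-models\<close>

datatype semantics = ASP | LPMLN

fun stable_model :: "semantics \<Rightarrow> 'a rule set \<Rightarrow> 'a set \<Rightarrow> bool" where
  "stable_model ASP = asp_stable_model"
| "stable_model LPMLN = lpmln_stable_model"

definition strong_equiv :: "semantics \<Rightarrow> 'a rule set \<Rightarrow> 'a rule set \<Rightarrow> bool" where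
  "strong_equiv s P Q \<longleftrightarrow>
     (\<forall>R. finite R \<longrightarrow> {X. stable_model s (P \<union> R) X} = {X. stable_model s (Q \<union> R) X})"

definition sat_reduct :: "'a set \<Rightarrow> 'a set \<Rightarrow> 'a rule \<Rightarrow> bool" where
  "sat_reduct X Y r \<longleftrightarrow> Y \<inter> H r \<noteq> {} \<or> \<not> Bpos r \<subseteq> Y \<or> Bneg r \<inter> X \<noteq> {}"

fun se_sat_rule :: "semantics \<Rightarrow> 'a set \<Rightarrow> 'a set \<Rightarrow> 'a rule \<Rightarrow> bool" where
  "se_sat_rule ASP X Y r \<longleftrightarrow> sat_reduct X X r \<and> sat_reduct X Y r"
| "se_sat_rule LPMLN X Y r \<longleftrightarrow> (sat_reduct X X r \<longrightarrow> sat_reduct X Y r)"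

definition se_model :: "semantics \<Rightarrow> 'a rule set \<Rightarrow> 'a set \<Rightarrow> 'a set \<Rightarrow> bool" where
  "se_model s P X Y \<longleftrightarrow> Y \<subseteq> X \<and> (\<forall>r\<in>P. se_sat_rule s X Y r)"

lemma sat_rule_iff_sat_reduct: "sat_rule X r \<longleftrightarrow> sat_reduct X X r"
  by (simp add: sat_rule_def sat_reduct_def)

lemma sat_program_GL_reduct_iff: "sat_program Y (GL_reduct P X) \<longleftrightarrow> (\<forall>r\<in>P. sat_reduct X Y r)"
  unfolding sat_program_def GL_reduct_def sat_reduct_def sat_rule_def H_def Bpos_def Bneg_def
  by fastforce

lemma stable_model_iff_se_model:
  "stable_model s P X \<longleftrightarrow> se_model s P X X \<and> (\<forall>Y. Y \<subset> X \<longrightarrow> \<not> se_model s P X Y)"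
proof (cases s)
  case ASP
  then show ?thesis
    by (simp add: asp_stable_model_def sat_program_GL_reduct_iff se_model_def ball_conj_distrib)
      blast
next
  case LPMLN
  then show ?thesis
    by (simp add: lpmln_stable_model_def asp_stable_model_def sat_program_GL_reduct_iff
        sat_rule_iff_sat_reduct se_model_def) blast
qed

lemma se_model_Un: "se_model s (P \<union> R) X Y \<longleftrightarrow> se_model s P X Y \<and> se_model s R X Y"
  by (auto simp: se_model_def)

lemma se_model_imp_total: "se_model s P X Y \<Longrightarrow> se_model s P X X"
  by (cases s) (auto simp: se_model_def)

definition atoms :: "'a rule set \<Rightarrow> 'a set" where
  "atoms P = (\<Union>r\<in>P. H r \<union> Bpos r \<union> Bneg r)"

lemma finite_atoms: "finite P \<Longrightarrow> finite (atoms P)"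
  by (simp add: atoms_def H_def Bpos_def Bneg_def)

lemma se_model_Int_atoms:
  assumes "atoms P \<subseteq> A" "Y \<subseteq> X"
  shows "se_model s P (X \<inter> A) (Y \<inter> A) \<longleftrightarrow> se_model s P X Y"
proof -
  have "sat_reduct (X \<inter> A) (Z \<inter> A) r \<longleftrightarrow> sat_reduct X Z r" if "r \<in> P" for r Z
  proof -
    have "H r \<subseteq> A" "Bpos r \<subseteq> A" "Bneg r \<subseteq> A"
      using assms(1) that by (auto simp: atoms_def)
    then show ?thesis
      unfolding sat_reduct_def by blast
  qed
  then show ?thesis
    using assms(2) by (cases s) (auto simp: se_model_def)
qed

definition isolating_program :: "'a set \<Rightarrow> 'a set \<Rightarrow> 'a rule set" where
  "isolating_program X Y = (\<lambda>a. Rule [a] [] []) ` Y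
     \<union> (\<lambda>(a, b). Rule [a] [b] []) ` ((X - Y) \<times> (X - Y))"

lemma finite_isolating_program: "finite X \<Longrightarrow> Y \<subseteq> X \<Longrightarrow> finite (isolating_program X Y)"
  by (auto simp: isolating_program_def intro: finite_subset)

lemma se_model_isolating_program:
  assumes "Y \<subseteq> X"
  shows "se_model s (isolating_program X Y) X Z \<longleftrightarrow> Z = Y \<or> Z = X"
proof -
  have sat_iff: "(\<forall>r\<in>isolating_program X Y. sat_reduct X Z r) \<longleftrightarrow>
      Y \<subseteq> Z \<and> (\<forall>a\<in>X - Y. \<forall>b\<in>X - Y. b \<in> Z \<longrightarrow> a \<in> Z)" for Z
    by (auto simp: isolating_program_def sat_reduct_def H_def Bpos_def Bneg_def ball_Un)
  have "\<forall>r\<in>isolating_program X Y. sat_reduct X X r"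
    using sat_iff[of X] assms by blast
  then have "se_model s (isolating_program X Y) X Z \<longleftrightarrow>
      Z \<subseteq> X \<and> (\<forall>r\<in>isolating_program X Y. sat_reduct X Z r)"
    by (cases s) (auto simp: se_model_def)
  also have "\<dots> \<longleftrightarrow> Z = Y \<or> Z = X"
    unfolding sat_iff using assms by blast
  finally show ?thesis .
qed

lemma stable_model_Un_isolating_program:
  assumes "Y \<subseteq> X"
  shows "stable_model s (P \<union> isolating_program X Y) X \<longleftrightarrow>
    se_model s P X X \<and> (Y = X \<or> \<not> se_model s P X Y)"
  using assms
  by (auto simp: stable_model_iff_se_model se_model_Un se_model_isolating_program psubset_eq)

lemma strong_equiv_imp_se_model_eq_finite:
  assumes "strong_equiv s P Q" "finite X" "Y \<subseteq> X"
  shows "se_model s P X Y \<longleftrightarrow> se_model s Q X Y"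
proof -
  have isolated_eq: "stable_model s (P \<union> isolating_program X Z) X \<longleftrightarrow>
      stable_model s (Q \<union> isolating_program X Z) X" if "Z \<subseteq> X" for Z
    using assms(1) finite_isolating_program[OF assms(2) that] by (auto simp: strong_equiv_def)
  have "se_model s P X X \<longleftrightarrow> se_model s Q X X"
    using isolated_eq[of X] by (simp add: stable_model_Un_isolating_program)
  then show ?thesis
    using isolated_eq[OF assms(3)] assms(3) se_model_imp_total[of s _ X Y]
    by (auto simp: stable_model_Un_isolating_program)
qed

lemma strong_equiv_iff_se_model:
  assumes "finite P" "finite Q"
  shows "strong_equiv s P Q \<longleftrightarrow> (\<forall>X Y. Y \<subseteq> X \<longrightarrow> se_model s P X Y = se_model s Q X Y)"
proof
  assume equiv: "strong_equiv s P Q"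
  define A where "A = atoms P \<union> atoms Q"
  have atoms_subset: "atoms P \<subseteq> A" "atoms Q \<subseteq> A"
    by (simp_all add: A_def)
  have finite_Int_A: "finite (X \<inter> A)" for X
    using assms by (simp add: A_def finite_atoms)
  show "\<forall>X Y. Y \<subseteq> X \<longrightarrow> se_model s P X Y = se_model s Q X Y"
  proof (intro allI impI)
    fix X Y :: "'a set"
    assume "Y \<subseteq> X"
    have "se_model s P X Y \<longleftrightarrow> se_model s P (X \<inter> A) (Y \<inter> A)"
      using se_model_Int_atoms[OF atoms_subset(1) \<open>Y \<subseteq> X\<close>] ..
    also have "\<dots> \<longleftrightarrow> se_model s Q (X \<inter> A) (Y \<inter> A)"
      using equiv finite_Int_A Int_mono[OF \<open>Y \<subseteq> X\<close> subset_refl]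
      by (rule strong_equiv_imp_se_model_eq_finite)
    also have "\<dots> \<longleftrightarrow> se_model s Q X Y"
      using se_model_Int_atoms[OF atoms_subset(2) \<open>Y \<subseteq> X\<close>] .
    finally show "se_model s P X Y = se_model s Q X Y" .
  qed
next
  assume "\<forall>X Y. Y \<subseteq> X \<longrightarrow> se_model s P X Y = se_model s Q X Y"
  then have "stable_model s (P \<union> R) X \<longleftrightarrow> stable_model s (Q \<union> R) X" for R X
    unfolding stable_model_iff_se_model se_model_Un by (meson psubset_imp_subset subset_refl)
  then show "strong_equiv s P Q"
    by (simp add: strong_equiv_def)
qed

section \<open>Independent sets\<close>

lemma length_component_sets: "length (component_sets T) = 3 * length T"
  by (induction T) (auto simp: component_sets_def)

definition rule_rel :: "('a set \<Rightarrow> 'b set \<Rightarrow> bool) \<Rightarrow> 'a rule \<Rightarrow> 'b rule \<Rightarrow> bool" where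
  "rule_rel R r r' \<longleftrightarrow> R (H r) (H r') \<and> R (Bpos r) (Bpos r') \<and> R (Bneg r) (Bneg r')"

lemma list_all2_component_sets_imp_rule_rel:
  assumes "length T = length T'" "list_all2 R (component_sets T) (component_sets T')"
  shows "list_all2 (rule_rel R) T T'"
  using assms
  by (induction T T' rule: list_induct2) (auto simp: component_sets_def rule_rel_def)

lemma list_all2_rule_relI:
  assumes "length T = length T'"
    and "\<And>i. i \<in> {1..3 * length T} \<Longrightarrow> R (component T i) (component T' i)"
  shows "list_all2 (rule_rel R) T T'"
proof (rule list_all2_component_sets_imp_rule_rel[OF assms(1)])
  show "list_all2 R (component_sets T) (component_sets T')"
  proof (rule list_all2_all_nthI)
    fix k assume "k < length (component_sets T)"
    then show "R (component_sets T ! k) (component_sets T' ! k)"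
      using assms(2)[of "Suc k"] by (simp add: component_def length_component_sets)
  qed (simp add: assms(1) length_component_sets)
qed

definition occurrences :: "'a rule list \<Rightarrow> 'a \<Rightarrow> nat set" where
  "occurrences T a = {i \<in> {1..3 * length T}. a \<in> component T i}"

lemma ind_set_eq_occurrences:
  assumes "N \<subseteq> {1..3 * length T}"
  shows "ind_set T N = {a. occurrences T a = N}"
  using assms unfolding ind_set_def occurrences_def by blast

lemma component_eq_UN_ind_set:
  assumes "i \<in> {1..3 * length T}"
  shows "component T i = (\<Union>N\<in>{N. N \<subseteq> {1..3 * length T} \<and> i \<in> N}. ind_set T N)"
proof (rule set_eqI)
  fix a
  have "a \<in> component T i \<longleftrightarrow> i \<in> occurrences T a"
    using assms by (simp add: occurrences_def)
  also have "\<dots> \<longleftrightarrow> occurrences T a \<in> {N. N \<subseteq> {1..3 * length T} \<and> i \<in> N}"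
    by (auto simp: occurrences_def)
  also have "\<dots> \<longleftrightarrow> a \<in> (\<Union>N\<in>{N. N \<subseteq> {1..3 * length T} \<and> i \<in> N}. ind_set T N)"
    by (auto simp: ind_set_eq_occurrences)
  finally show "a \<in> component T i \<longleftrightarrow>
      a \<in> (\<Union>N\<in>{N. N \<subseteq> {1..3 * length T} \<and> i \<in> N}. ind_set T N)" .
qed

lemma inj_on_ind_set_name: "inj_on (ind_set_name T) (Pow {1..3 * length T})"
proof (rule inj_onI)
  fix M N
  assume subsets: "M \<in> Pow {1..3 * length T}" "N \<in> Pow {1..3 * length T}"
    and name_eq: "ind_set_name T M = ind_set_name T N"
  let ?f = "\<lambda>i. 3 * length T - i"
  have inj_reflect: "inj_on ?f {1..3 * length T}"
    unfolding inj_on_def by (metis atLeastAtMost_iff diff_diff_cancel)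
  have name_eq_set_encode: "ind_set_name T K = set_encode (?f ` K)"
    if "K \<in> Pow {1..3 * length T}" for K
    using inj_on_subset[OF inj_reflect, of K] that
    by (simp add: ind_set_name_def set_encode_def sum.reindex)
  have "finite (?f ` M)" "finite (?f ` N)"
    using subsets by (auto intro: finite_subset)
  then have "?f ` M = ?f ` N"
    using name_eq subsets by (simp add: name_eq_set_encode set_encode_eq)
  then show "M = N"
    using inj_reflect subsets by (simp add: inj_on_image_eq_iff)
qed

lemma ind_set_name_cong: "length T = length T' \<Longrightarrow> ind_set_name T = ind_set_name T'"
  by (simp add: ind_set_name_def fun_eq_iff)

lemma ind_set_name_mem_iff:
  assumes "N \<noteq> {}" "N \<subseteq> {1..3 * length T}"
  shows "ind_set_name T N \<in>
    {ind_set_name T M | M. M \<noteq> {} \<and> M \<subseteq> {1..3 * length T} \<and> \<Phi> M} \<longleftrightarrow> \<Phi> N"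
  using assms inj_onD[OF inj_on_ind_set_name, of T N] by blast

lemma nis_eq_imp_ind_set_empty_iff:
  assumes "length T = length T'" "nis T = nis T'" "N \<noteq> {}" "N \<subseteq> {1..3 * length T}"
  shows "ind_set T N = {} \<longleftrightarrow> ind_set T' N = {}"
proof -
  have "ind_set_name T N \<in> nis T \<longleftrightarrow> ind_set T N \<noteq> {}"
    using assms(3,4) unfolding nis_def by (rule ind_set_name_mem_iff)
  moreover have "ind_set_name T' N \<in> nis T' \<longleftrightarrow> ind_set T' N \<noteq> {}"
    using assms unfolding nis_def by (intro ind_set_name_mem_iff) simp_all
  ultimately show ?thesis
    using assms(2) ind_set_name_cong[OF assms(1)] by simp
qed

lemma sis_subset_imp_card_ind_set_eq_1:
  assumes "length T = length T'" "sis T \<subseteq> sis T'" "N \<noteq> {}" "N \<subseteq> {1..3 * length T}"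
    and "card (ind_set T N) = 1"
  shows "card (ind_set T' N) = 1"
proof -
  have "ind_set_name T N \<in> sis T \<longleftrightarrow> card (ind_set T N) = 1"
    using assms(3,4) unfolding sis_def by (rule ind_set_name_mem_iff)
  moreover have "ind_set_name T' N \<in> sis T' \<longleftrightarrow> card (ind_set T' N) = 1"
    using assms(1,3,4) unfolding sis_def by (intro ind_set_name_mem_iff) simp_all
  ultimately show ?thesis
    using assms(2,5) ind_set_name_cong[OF assms(1)] by auto
qed

section \<open>Traces of a chain of sets\<close>

definition same_trace :: "'a set set \<Rightarrow> 'a set \<Rightarrow> 'a set \<Rightarrow> bool" where
  "same_trace \<Z> B C \<longleftrightarrow> (\<forall>Z\<in>\<Z>. (B \<inter> Z = {} \<longleftrightarrow> C \<inter> Z = {}) \<and> (B \<subseteq> Z \<longleftrightarrow> C \<subseteq> Z))"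

lemma same_trace_UN:
  fixes B C :: "'i \<Rightarrow> 'a set"
  assumes "\<And>i. i \<in> I \<Longrightarrow> same_trace \<Z> (B i) (C i)"
  shows "same_trace \<Z> (\<Union>i\<in>I. B i) (\<Union>i\<in>I. C i)"
proof -
  have "(\<Union>i\<in>I. D i) \<inter> Z = {} \<longleftrightarrow> (\<forall>i\<in>I. D i \<inter> Z = {})"
    for D :: "'i \<Rightarrow> 'a set" and Z
    by blast
  then show ?thesis
    using assms by (simp add: same_trace_def UN_subset_iff)
qed

lemma finite_chain_obtains_mem_all_meeting:
  assumes "finite \<Z>" "subset.chain UNIV \<Z>" "B \<noteq> {}"
  obtains b where "b \<in> B" "\<And>Z. Z \<in> \<Z> \<Longrightarrow> B \<inter> Z \<noteq> {} \<Longrightarrow> b \<in> Z"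
proof (cases "{Z \<in> \<Z>. B \<inter> Z \<noteq> {}} = {}")
  case True
  then show ?thesis
    using assms(3) that by blast
next
  case False
  have "subset.chain UNIV {Z \<in> \<Z>. B \<inter> Z \<noteq> {}}"
    using assms(2) by (auto simp: subset_chain_def)
  then have "\<Inter>{Z \<in> \<Z>. B \<inter> Z \<noteq> {}} \<in> {Z \<in> \<Z>. B \<inter> Z \<noteq> {}}"
    using Inter_in_chain[of "{Z \<in> \<Z>. B \<inter> Z \<noteq> {}}"] assms(1) False by simp
  then show ?thesis
    using that by blast
qed

lemma finite_chain_obtains_pair_same_trace:
  assumes "finite \<Z>" "subset.chain UNIV \<Z>" "B \<noteq> {}"
  obtains a b where "same_trace \<Z> {a, b} B"
proof -
  obtain b where top: "b \<in> B" "\<And>Z. Z \<in> \<Z> \<Longrightarrow> B \<inter> Z \<noteq> {} \<Longrightarrow> b \<in> Z"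
    using finite_chain_obtains_mem_all_meeting[OF assms] by blast
  have "subset.chain UNIV (uminus ` \<Z>)"
    using assms(2) by (auto simp: subset_chain_def)
  then obtain a where bottom: "a \<in> B" "\<And>Z. Z \<in> uminus ` \<Z> \<Longrightarrow> B \<inter> Z \<noteq> {} \<Longrightarrow> a \<in> Z"
    using finite_chain_obtains_mem_all_meeting[of "uminus ` \<Z>" B] assms by blast
  have "a \<notin> Z" if "Z \<in> \<Z>" "\<not> B \<subseteq> Z" for Z
    using bottom(2)[of "- Z"] that by blast
  then have "same_trace \<Z> {a, b} B"
    using bottom(1) top unfolding same_trace_def by blast
  then show ?thesis
    by (rule that)
qed

lemma finite_chain_obtains_map_same_trace:
  assumes "finite \<Z>" "subset.chain UNIV \<Z>"
    and "C = {} \<longleftrightarrow> B = {}" "card C = 1 \<Longrightarrow> card B = 1"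
  obtains g where "same_trace \<Z> (g ` C) B"
proof -
  consider (empty) "C = {}" | (singleton) u where "C = {u}"
    | (two_elements) u v where "u \<in> C" "v \<in> C" "u \<noteq> v"
    by blast
  then show ?thesis
  proof cases
    case empty
    then show ?thesis
      using assms(3) that by (simp add: same_trace_def)
  next
    case (singleton u)
    then obtain b where "B = {b}"
      using assms(4) by (auto simp: card_1_singleton_iff)
    then show ?thesis
      using singleton that[of "\<lambda>_. b"] by (simp add: same_trace_def)
  next
    case (two_elements u v)
    then obtain a b where trace: "same_trace \<Z> {a, b} B"
      using finite_chain_obtains_pair_same_trace[OF assms(1,2)] assms(3) by blast
    have "((\<lambda>_. b)(u := a)) ` C = {a, b}"
      using two_elements by auto
    then show ?thesis
      using trace that by metis
  qed
qed

section \<open>Transfer of SE-models along a map of atoms\<close>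

lemma obtains_map_same_trace_ind_set:
  assumes "length T = length T'" "nis T = nis T'" "sis T' \<subseteq> sis T"
    and "finite \<Z>" "subset.chain UNIV \<Z>"
  obtains g where "\<And>N. N \<noteq> {} \<Longrightarrow> N \<subseteq> {1..3 * length T} \<Longrightarrow>
    same_trace \<Z> (g ` ind_set T' N) (ind_set T N)"
proof -
  let ?\<N> = "{N. N \<noteq> {} \<and> N \<subseteq> {1..3 * length T}}"
  have "\<exists>f. same_trace \<Z> (f ` ind_set T' N) (ind_set T N)" if "N \<in> ?\<N>" for N
    using finite_chain_obtains_map_same_trace[OF assms(4,5), of "ind_set T' N" "ind_set T N"]
      nis_eq_imp_ind_set_empty_iff[OF assms(1,2), of N]
      sis_subset_imp_card_ind_set_eq_1[OF assms(1)[symmetric] assms(3), of N] that assms(1)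
    by auto
  then obtain f where f_trace: "\<And>N. N \<in> ?\<N> \<Longrightarrow> same_trace \<Z> (f N ` ind_set T' N) (ind_set T N)"
    by metis
  define g where "g a = f (occurrences T' a) a" for a
  have "g ` ind_set T' N = f N ` ind_set T' N" if "N \<in> ?\<N>" for N
    using that assms(1) by (intro image_cong) (simp_all add: g_def ind_set_eq_occurrences)
  then show ?thesis
    using f_trace that[of g] by simp
qed

lemma obtains_map_rule_rel_same_trace:
  assumes "length T = length T'" "nis T = nis T'" "sis T' \<subseteq> sis T"
    and "finite \<Z>" "subset.chain UNIV \<Z>"
  obtains g where "list_all2 (rule_rel (\<lambda>B. same_trace \<Z> (g ` B))) T' T"
proof -
  obtain g where g_trace: "\<And>N. N \<noteq> {} \<Longrightarrow> N \<subseteq> {1..3 * length T} \<Longrightarrow>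
      same_trace \<Z> (g ` ind_set T' N) (ind_set T N)"
    using obtains_map_same_trace_ind_set[OF assms] by blast
  have "same_trace \<Z> (g ` component T' i) (component T i)" if "i \<in> {1..3 * length T}" for i
    unfolding component_eq_UN_ind_set[OF that]
      component_eq_UN_ind_set[OF that[unfolded assms(1)]] image_UN assms(1)
    by (rule same_trace_UN) (use g_trace assms(1) in auto)
  then have "list_all2 (rule_rel (\<lambda>B. same_trace \<Z> (g ` B))) T' T"
    using assms(1) by (intro list_all2_rule_relI) simp_all
  then show ?thesis
    by (rule that)
qed

lemma same_trace_image_vimage_iff:
  assumes "same_trace \<Z> (g ` B) C" "Z \<in> \<Z>"
  shows "B \<inter> g -` Z = {} \<longleftrightarrow> C \<inter> Z = {}" "B \<subseteq> g -` Z \<longleftrightarrow> C \<subseteq> Z"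
proof -
  have "B \<inter> g -` Z = {} \<longleftrightarrow> g ` B \<inter> Z = {}"
    by blast
  then show "B \<inter> g -` Z = {} \<longleftrightarrow> C \<inter> Z = {}"
    using assms by (simp add: same_trace_def)
  show "B \<subseteq> g -` Z \<longleftrightarrow> C \<subseteq> Z"
    using assms by (simp add: same_trace_def image_subset_iff_subset_vimage[symmetric])
qed

lemma sat_reduct_vimage:
  assumes "rule_rel (\<lambda>B. same_trace \<Z> (g ` B)) r' r" "X \<in> \<Z>" "Y \<in> \<Z>"
  shows "sat_reduct (g -` X) (g -` Y) r' \<longleftrightarrow> sat_reduct X Y r"
proof -
  have "same_trace \<Z> (g ` H r') (H r)" "same_trace \<Z> (g ` Bpos r') (Bpos r)"
    "same_trace \<Z> (g ` Bneg r') (Bneg r)"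
    using assms(1) by (simp_all add: rule_rel_def)
  from this[THEN same_trace_image_vimage_iff(1)] this[THEN same_trace_image_vimage_iff(2)]
  show ?thesis
    using assms(2,3) by (simp add: sat_reduct_def Int_commute)
qed

lemma se_model_vimage:
  assumes "list_all2 (rule_rel (\<lambda>B. same_trace {X, Y} (g ` B))) T' T" "Y \<subseteq> X"
  shows "se_model s (set T') (g -` X) (g -` Y) \<longleftrightarrow> se_model s (set T) X Y"
proof -
  have "se_sat_rule s (g -` X) (g -` Y) r' \<longleftrightarrow> se_sat_rule s X Y r"
    if "rule_rel (\<lambda>B. same_trace {X, Y} (g ` B)) r' r" for r r'
    using sat_reduct_vimage[OF that] by (cases s) simp_all
  with assms(1) have "(\<forall>r'\<in>set T'. se_sat_rule s (g -` X) (g -` Y) r') \<longleftrightarrow>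
      (\<forall>r\<in>set T. se_sat_rule s X Y r)"
    by (induction rule: list_all2_induct) auto
  then show ?thesis
    using assms(2) by (simp add: se_model_def vimage_mono)
qed

lemma strong_equiv_transfer:
  fixes P1 Q1 :: "'a rule list" and P2 Q2 :: "'b rule list"
  assumes "length P1 = length P2" "length Q1 = length Q2"
    and "nis (P1 @ Q1) = nis (P2 @ Q2)" "sis (P2 @ Q2) \<subseteq> sis (P1 @ Q1)"
    and "strong_equiv s (set P2) (set Q2)"
  shows "strong_equiv s (set P1) (set Q1)"
  unfolding strong_equiv_iff_se_model[OF finite_set finite_set]
proof (intro allI impI)
  fix X Y :: "'a set"
  assume "Y \<subseteq> X"
  then have "subset.chain UNIV {X, Y}"
    by (auto simp: subset_chain_def)
  then obtain g where "list_all2 (rule_rel (\<lambda>B. same_trace {X, Y} (g ` B))) (P2 @ Q2) (P1 @ Q1)"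
    using obtains_map_rule_rel_same_trace[of "P1 @ Q1" "P2 @ Q2" "{X, Y}"] assms(1-4) by auto
  then have P_rel: "list_all2 (rule_rel (\<lambda>B. same_trace {X, Y} (g ` B))) P2 P1"
    and Q_rel: "list_all2 (rule_rel (\<lambda>B. same_trace {X, Y} (g ` B))) Q2 Q1"
    using assms(1) by (simp_all add: list_all2_append)
  have "se_model s (set P1) X Y \<longleftrightarrow> se_model s (set P2) (g -` X) (g -` Y)"
    using se_model_vimage[OF P_rel \<open>Y \<subseteq> X\<close>] ..
  also have "\<dots> \<longleftrightarrow> se_model s (set Q2) (g -` X) (g -` Y)"
    using assms(5) vimage_mono[OF \<open>Y \<subseteq> X\<close>, of g] by (simp add: strong_equiv_iff_se_model)
  also have "\<dots> \<longleftrightarrow> se_model s (set Q1) X Y"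
    by (rule se_model_vimage[OF Q_rel \<open>Y \<subseteq> X\<close>])
  finally show "se_model s (set P1) X Y = se_model s (set Q1) X Y" .
qed

theorem theorem8:
  fixes P1 Q1 P2 Q2 :: "'a rule list"
    and eqv :: "'a rule list \<Rightarrow> 'a rule list \<Rightarrow> bool"
  assumes "eqv = strong_equiv_asp \<or> eqv = strong_equiv_lpmln"
    and "(P1, Q1) \<approx> (P2, Q2)"
  shows "(IC_eq (P1, Q1) (P2, Q2) \<longrightarrow> (eqv P1 Q1 \<longleftrightarrow> eqv P2 Q2)) \<and>
    (IC_less (P1, Q1) (P2, Q2) \<longrightarrow>
      (\<not> eqv P1 Q1 \<longrightarrow> \<not> eqv P2 Q2) \<and> (eqv P2 Q2 \<longrightarrow> eqv P1 Q1))"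
proof -
  have "strong_equiv_asp P Q = strong_equiv ASP (set P) (set Q)"
    "strong_equiv_lpmln P Q = strong_equiv LPMLN (set P) (set Q)" for P Q :: "'a rule list"
    by (simp_all add: strong_equiv_def strong_equiv_asp_def strong_equiv_lpmln_def)
  then obtain s where eqv: "\<And>P Q. eqv P Q = strong_equiv s (set P) (set Q)"
    using assms(1) by blast
  have "length P1 = length P2" "length Q1 = length Q2"
    using assms(2) by (simp_all add: similar_def)
  then show ?thesis
    using strong_equiv_transfer[of P1 P2 Q1 Q2 s] strong_equiv_transfer[of P2 P1 Q2 Q1 s]
    by (auto simp: eqv IC_eq_def IC_less_def pair_tuple_def)
qed

end
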